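(* Let $X$ be a Hausdorff locally convex topological vector space, let $K$ be a nonempty convex closed subset of $X$, let $D\subseteq K$ be a self segment-dense set in $K$, and let $F:K\times K\rightrightarrows\mathbb{R}$ be a set-valued map satisfying: (i) for all $y\in D$, the map $x\mapsto F(x,y)$ is upper semicontinuous on $K$; (ii) for all $x\in K$, the map $y\mapsto F(x,y)$ is upper semicontinuous on $K\setminus D$; (iii) for all $x\in D$, the map $y\mapsto F(x,y)$ is concave on $D$; (iv) for all $x\in D$, $F(x,x)\cap\mathbb{R}_+\neq\emptyset$; (v) there exist a compact set $K_0\subseteq X$ and $y_0\in D\cap K_0$ such that $F(x,y_0)\cap\mathbb{R}_+=\emptyset$ for all $x\in K\setminus K_0$. Then there exists $x_0\in K$ such that $F(x_0,y)\cap\mathbb{R}_+\neq\emptyset$ for all $y\in K$.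
   Context: Self segment-dense: for $U\subseteq V\subseteq X$ with $V$ convex, $U$ is self segment-dense in $V$ if $U$ is dense in $V$ (i.e. $V\subseteq\operatorname{cl}(U)$) and for all $x,y\in U$ the set $[x,y]\cap U$ is dense in the closed segment $[x,y]=\{x+t(y-x):t\in[0,1]\}$. Notation: $\mathbb{R}_+=[0,\infty)$. Upper semicontinuity: a set-valued map $T:A\rightrightarrows\mathbb{R}$ on a topological space $A$ (here $A=K$ with the subspace topology), with domain $D(T)=\{x\in A:T(x)\ne\emptyset\}$, is upper semicontinuous at $x\in D(T)$ if for every open $N\subseteq\mathbb{R}$ with $T(x)\subseteq N$ there is a neighborhood $M$ of $x$ in $A$ such that $T(y)\subseteq N$ for all $y\in M$. It is upper semicontinuous on $S\subseteq A$ if it is upper semicontinuous at every point of $S$ (so in particular $S\subseteq D(T)$); here $T$ is still regarded as a map on all of $A$. Concavity on a not necessarily convex set: $T$ is concave on $D$ if for all $x_1,\dots,x_n\in D$ and $\lambda_i\ge0$ with $\sum_{i=1}^n\lambda_i=1$ and $\sum_{i=1}^n\lambda_ix_i\in D$ one has $\sum_{i=1}^n\lambda_iT(x_i)\supseteq T\left(\sum_{i=1}^n\lambda_ix_i\right)$ (Minkowski sum). *)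

theory Defs
  imports "HOL-Analysis.Analysis"
begin

text \<open>
  Hausdorff locally convex topological vector spaces over the reals. Continuity of addition is
  inherited from \<^class>\<open>topological_ab_group_add\<close>. Local convexity is stated at \<open>0\<close> only, which
  suffices because translations are homeomorphisms; convexity of \<open>V\<close> is spelled out since the
  constant \<^const>\<open>convex\<close> cannot be used inside the class specification.
\<close>

class t2_locally_convex_space = real_vector + topological_ab_group_add + t2_space +
  assumes tendsto_scaleR_Pair:
    "LIM p (nhds a \<times>\<^sub>F nhds b). fst p *\<^sub>R snd p :> nhds (a *\<^sub>R b)"
  and convex_nhds_zero:
    "open U \<Longrightarrow> 0 \<in> U \<Longrightarrow> \<exists>V. open V \<and> 0 \<in> V \<and> V \<subseteq> U \<and>
      (\<forall>x\<in>V. \<forall>y\<in>V. \<forall>u\<ge>0. \<forall>v\<ge>0. u + v = 1 \<longrightarrow> u *\<^sub>R x + v *\<^sub>R y \<in> V)"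

instance real_normed_vector \<subseteq> t2_locally_convex_space
proof
  fix a :: real and b :: 'a
  show "LIM p (nhds a \<times>\<^sub>F nhds b). fst p *\<^sub>R snd p :> nhds (a *\<^sub>R b)"
    by (intro tendsto_scaleR filterlim_fst filterlim_snd)
next
  fix U :: "'a set"
  assume "open U" "0 \<in> U"
  then obtain e where "e > 0" "ball 0 e \<subseteq> U"
    by (meson open_contains_ball)
  then show "\<exists>V. open V \<and> 0 \<in> V \<and> V \<subseteq> U \<and>
      (\<forall>x\<in>V. \<forall>y\<in>V. \<forall>u\<ge>0. \<forall>v\<ge>0. u + v = 1 \<longrightarrow> u *\<^sub>R x + v *\<^sub>R y \<in> V)"
    using convex_ball[of 0 e] unfolding convex_def
    by (intro exI[of _ "ball 0 e"]) simp
qed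

definition self_segment_dense :: "'a::t2_locally_convex_space set \<Rightarrow> 'a set \<Rightarrow> bool" where
  "self_segment_dense U V \<longleftrightarrow>
     convex V \<and> U \<subseteq> V \<and> V \<subseteq> closure U \<and>
     (\<forall>x\<in>U. \<forall>y\<in>U. closed_segment x y \<subseteq> closure (closed_segment x y \<inter> U))"

text \<open>
  A set-valued map on \<open>A\<close> is a function into sets of which only the values on \<open>A\<close> matter, and
  neighbourhoods are taken in the subspace topology of \<open>A\<close>. In \<open>usc_on A T S\<close> the map is
  still regarded as a map on \<open>A\<close>, i.e. it is not restricted to \<open>S\<close>. Upper semicontinuity at a
  point includes nonemptiness of the value there.
\<close>

definition usc_at :: "'a::topological_space set \<Rightarrow> ('a \<Rightarrow> 'b::topological_space set) \<Rightarrow> 'a \<Rightarrow> bool" where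
  "usc_at A T x \<longleftrightarrow>
     x \<in> A \<and> T x \<noteq> {} \<and>
     (\<forall>N. open N \<and> T x \<subseteq> N \<longrightarrow>
        (\<exists>M. openin (top_of_set A) M \<and> x \<in> M \<and> (\<forall>y\<in>M. T y \<subseteq> N)))"

definition usc_on :: "'a::topological_space set \<Rightarrow> ('a \<Rightarrow> 'b::topological_space set) \<Rightarrow> 'a set \<Rightarrow> bool" where
  "usc_on A T S \<longleftrightarrow> (\<forall>x\<in>S. usc_at A T x)"

text \<open>
  The sum over \<open>i < n\<close> of sets is the iterated Minkowski sum; it is empty as soon as one summand
  is, in particular \<open>0 *o {} = {}\<close>.
\<close>

definition set_concave_on :: "'a::real_vector set \<Rightarrow> ('a \<Rightarrow> real set) \<Rightarrow> bool" where
  "set_concave_on D T \<longleftrightarrow>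
     (\<forall>(n::nat) (x :: nat \<Rightarrow> 'a) (l :: nat \<Rightarrow> real).
        (\<forall>i<n. x i \<in> D \<and> 0 \<le> l i) \<and> (\<Sum>i<n. l i) = 1 \<and> (\<Sum>i<n. l i *\<^sub>R x i) \<in> D \<longrightarrow>
        T (\<Sum>i<n. l i *\<^sub>R x i) \<subseteq> (\<Sum>i<n. l i *o T (x i)))"

end

theory Submission
  imports Defs
begin

text \<open>
  For \<open>y \<in> D\<close> the set \<open>G y\<close> of those \<open>x\<close> with \<open>F(x,y) \<inter> [0,\<infinity>) \<noteq> \<emptyset>\<close> is closed by (i), and by (iii)
  and (iv) the hull of finitely many \<open>y\<^sub>i \<in> D\<close> meets \<open>D\<close> only in points of \<open>\<Union>G(y\<^sub>i)\<close>. Self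
  segment-density makes \<open>D\<close> dense in that hull, so the \<open>G(y\<^sub>i)\<close> cover the whole hull and the
  Knaster--Kuratowski--Mazurkiewicz theorem applies; (v) supplies the compactness needed to pass to
  all of \<open>D\<close>, and (ii) extends the conclusion from \<open>D\<close> to its closure.

  The KKM theorem is derived from Kuhn's combinatorial lemma on the grid of the cube \<open>[0,1]\<^sup>n\<close>, which
  is mapped to the simplex by stick-breaking coordinates. This works for all \<open>n\<close> at once, whereas
  Brouwer's theorem in the library fixes the dimension by a type.
\<close>

section \<open>Kuhn's lemma on the grid and its limit on the cube\<close>

text \<open>The vertices of a Kuhn simplex lie in one grid cell with base \<open>b\<close>, so a
  fully labelled simplex shows all \<open>n + 1\<close> labels in that cell. Its coordinates from
  \<open>n\<close> on are constantly \<open>p\<close>, whence \<open>b j \<le> p\<close> rather than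
  \<open>b j < p\<close>.\<close>

lemma kuhn_rainbow:
  fixes n p :: nat and k :: "(nat \<Rightarrow> nat) \<Rightarrow> nat"
  assumes "0 < p"
    and k_le: "\<And>x. \<forall>j. x j \<le> p \<Longrightarrow> k x \<le> n"
    and k_0: "\<And>x j. \<forall>j. x j \<le> p \<Longrightarrow> j < n \<Longrightarrow> x j = 0 \<Longrightarrow> k x \<noteq> j"
    and k_p: "\<And>x j. \<forall>j. x j \<le> p \<Longrightarrow> j < n \<Longrightarrow> x j = p \<Longrightarrow> k x \<le> j"
  shows "\<exists>b. (\<forall>j. b j \<le> p) \<and>
    (\<forall>i\<le>n. \<exists>x. (\<forall>j. x j \<le> p \<and> b j \<le> x j \<and> x j \<le> Suc (b j)) \<and> k x = i)"
proof -
  \<comment> \<open>The clause \<open>x j = p\<close> only serves the boundary condition of Kuhn's lemma: by \<open>k_p\<close> it cannot lower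
    the first index with label 1, so \<open>reduced n\<close> still recovers \<open>k\<close>.\<close>
  define lab :: "(nat \<Rightarrow> nat) \<Rightarrow> nat \<Rightarrow> nat"
    where "lab x j = (if j = k x \<or> x j = p then 1 else 0)" for x j
  have red: "reduced n (lab x) = k x" if "\<forall>j. x j \<le> p" for x
  proof (rule reduced_labelling_unique)
    show "k x \<le> n" by (rule k_le[OF that])
    then have "x i \<noteq> p" if "i < k x" for i
      using k_p[OF \<open>\<forall>j. x j \<le> p\<close>, of i] that by auto
    then show "\<forall>i<k x. lab x i = 0" by (auto simp: lab_def)
    show "k x = n \<or> lab x (k x) \<noteq> 0" by (simp add: lab_def)
  qed
  have "odd (card {s. ksimplex p n s \<and> (reduced n \<circ> lab) ` s = {..n}})"
    using \<open>0 < p\<close> k_0 by (intro kuhn_combinatorial) (auto simp: lab_def)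
  then have "{s. ksimplex p n s \<and> (reduced n \<circ> lab) ` s = {..n}} \<noteq> {}"
    by (rule odd_card_imp_not_empty)
  then obtain s b u where "kuhn_simplex p n b u s" and rl: "(reduced n \<circ> lab) ` s = {..n}"
    by (auto elim: ksimplex.cases)
  interpret kuhn_simplex p n b u s by fact
  show ?thesis
  proof (rule exI[of _ b], intro conjI allI impI)
    fix j show "b j \<le> p" using s_le_p[OF base_in_s] .
  next
    fix i assume "i \<le> n"
    then obtain x where x: "x \<in> s" "reduced n (lab x) = i"
      using rl by (metis atMost_iff comp_apply imageE)
    moreover have "\<forall>j. x j \<le> p" using s_le_p x(1) by blast
    ultimately show "\<exists>x. (\<forall>j. x j \<le> p \<and> b j \<le> x j \<and> x j \<le> Suc (b j)) \<and> k x = i"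
      using red base_le le_Suc_base by metis
  qed
qed

lemma compact_unit_cube: "compact {t :: nat \<Rightarrow> real. \<forall>j. t j \<in> {0..1}}"
proof -
  have "compactin (product_topology (\<lambda>_::nat. euclidean) UNIV) (\<Pi>\<^sub>E j\<in>(UNIV::nat set). {0..1::real})"
    by (subst compactin_PiE) auto
  then show ?thesis
    by (simp add: euclidean_product_topology PiE_UNIV_domain Pi_def)
qed

text \<open>Grids of mesh \<open>1 / Suc m\<close> have cells carrying every label. Along a
  subsequence the bases of these cells converge, and the points of each label are dragged to the
  same limit; no continuity of \<open>k\<close> is involved. The cube has all of \<open>nat\<close>
  as index set, so that \<open>n\<close> remains an ordinary variable.\<close>

lemma cube_rainbow_limit:
  fixes n :: nat and k :: "(nat \<Rightarrow> real) \<Rightarrow> nat"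
  assumes k_le: "\<And>t. \<forall>j. t j \<in> {0..1} \<Longrightarrow> k t \<le> n"
    and k_0: "\<And>t j. \<forall>j. t j \<in> {0..1} \<Longrightarrow> j < n \<Longrightarrow> t j = 0 \<Longrightarrow> k t \<noteq> j"
    and k_1: "\<And>t j. \<forall>j. t j \<in> {0..1} \<Longrightarrow> j < n \<Longrightarrow> t j = 1 \<Longrightarrow> k t \<le> j"
  shows "\<exists>t. (\<forall>j. t j \<in> {0..1}) \<and> (\<forall>i\<le>n. \<exists>u :: nat \<Rightarrow> nat \<Rightarrow> real.
    (\<forall>m j. u m j \<in> {0..1}) \<and> (\<forall>m. k (u m) = i) \<and> (\<forall>j. (\<lambda>m. u m j) \<longlonglongrightarrow> t j))"
proof -
  define g :: "nat \<Rightarrow> (nat \<Rightarrow> nat) \<Rightarrow> nat \<Rightarrow> real" where "g m x j = x j / Suc m" for m x j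
  have g01: "\<forall>j. g m x j \<in> {0..1}" if "\<forall>j. x j \<le> Suc m" for m x
    using that by (auto simp: g_def divide_le_eq simp del: of_nat_Suc)
  have "\<exists>b. (\<forall>j. b j \<le> Suc m) \<and> (\<forall>i\<le>n. \<exists>x. (\<forall>j. x j \<le> Suc m \<and> b j \<le> x j \<and> x j \<le> Suc (b j)) \<and>
      k (g m x) = i)" for m
  proof (rule kuhn_rainbow)
    fix x :: "nat \<Rightarrow> nat" and j assume x: "\<forall>j. x j \<le> Suc m"
    show "k (g m x) \<le> n" by (rule k_le[OF g01[OF x]])
    assume j: "j < n"
    { assume "x j = 0" then show "k (g m x) \<noteq> j" by (intro k_0[OF g01[OF x] j]) (simp add: g_def) }
    { assume "x j = Suc m" then show "k (g m x) \<le> j"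
        by (intro k_1[OF g01[OF x] j]) (simp add: g_def del: of_nat_Suc) }
  qed simp
  then obtain b where b: "\<And>m j. b m j \<le> Suc m"
    and "\<And>m i. i \<le> n \<Longrightarrow> \<exists>x. (\<forall>j. x j \<le> Suc m \<and> b m j \<le> x j \<and> x j \<le> Suc (b m j)) \<and> k (g m x) = i"
    by metis
  then obtain x where x: "\<And>m i j. i \<le> n \<Longrightarrow> x i m j \<le> Suc m \<and> b m j \<le> x i m j \<and> x i m j \<le> Suc (b m j)"
    and kx: "\<And>m i. i \<le> n \<Longrightarrow> k (g m (x i m)) = i"
    by metis
  \<comment> \<open>A countable power of the reals is first countable, so compactness yields
    convergent subsequences. One subsequence \<open>r\<close>, chosen for the bases, serves all
    labels.\<close>
  have "seq_compact {t :: nat \<Rightarrow> real. \<forall>j. t j \<in> {0..1}}"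
    using compact_unit_cube by (rule compact_imp_seq_compact)
  then obtain t r where t: "\<forall>j. t j \<in> {0..1}" and r: "strict_mono r"
    and lim: "((\<lambda>m. g m (b m)) \<circ> r) \<longlonglongrightarrow> t"
    using g01 b by (auto elim!: seq_compactE[where f = "\<lambda>m. g m (b m)"])
  have limj: "(\<lambda>m. g (r m) (b (r m)) j) \<longlonglongrightarrow> t j" for j
    using continuous_on_tendsto_compose[OF continuous_on_product_coordinates lim] by simp
  have inv: "(\<lambda>m. 1 / real (Suc (r m))) \<longlonglongrightarrow> 0"
    using LIMSEQ_subseq_LIMSEQ[OF LIMSEQ_Suc[OF lim_1_over_n] r] by (simp add: comp_def)
  show ?thesis
  proof (intro exI[of _ t] conjI t allI impI)
    fix i assume i: "i \<le> n"
    define u where "u m = g (r m) (x i (r m))" for m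
    have "(\<lambda>m. u m j) \<longlonglongrightarrow> t j" for j
    proof (rule tendsto_sandwich[OF _ _ limj])
      have "g (r m) (b (r m)) j \<le> u m j \<and> u m j \<le> g (r m) (b (r m)) j + 1 / real (Suc (r m))" for m
        using x[OF i, of "r m" j]
        by (auto simp: u_def g_def add_divide_distrib[symmetric] intro!: divide_right_mono simp del: of_nat_Suc)
      then show "\<forall>\<^sub>F m in sequentially. g (r m) (b (r m)) j \<le> u m j"
        and "\<forall>\<^sub>F m in sequentially. u m j \<le> g (r m) (b (r m)) j + 1 / real (Suc (r m))"
        by simp_all
      show "(\<lambda>m. g (r m) (b (r m)) j + 1 / real (Suc (r m))) \<longlonglongrightarrow> t j"
        using tendsto_add[OF limj inv] by simp
    qed
    moreover have "k (u m) = i" for m by (simp add: u_def kx i)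
    moreover have "u m j \<in> {0..1}" for m j
      using g01[of "x i (r m)" "r m"] x[OF i] by (simp add: u_def)
    ultimately show "\<exists>u :: nat \<Rightarrow> nat \<Rightarrow> real. (\<forall>m j. u m j \<in> {0..1}) \<and> (\<forall>m. k (u m) = i) \<and>
        (\<forall>j. (\<lambda>m. u m j) \<longlonglongrightarrow> t j)"
      by blast
  qed
qed

section \<open>Stick-breaking coordinates and the KKM theorem\<close>

lemma tendsto_scaleR_lc:
  fixes y :: "'a::t2_locally_convex_space"
  assumes "(f \<longlongrightarrow> a) A" "(g \<longlongrightarrow> y) A"
  shows "((\<lambda>x. f x *\<^sub>R g x) \<longlongrightarrow> a *\<^sub>R y) A"
  using filterlim_compose[OF tendsto_scaleR_Pair filterlim_Pair[OF assms]] by simp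

text \<open>From a stick of length 1, piece \<open>i < n\<close> takes the fraction
  \<open>t i\<close> of what is left, and piece \<open>n\<close> takes the rest. Thus
  \<open>t j = 0\<close> annihilates weight \<open>j\<close>, and \<open>t j = 1\<close> all later
  weights: these are the boundary conditions of the cube labelling.\<close>

definition stick :: "nat \<Rightarrow> (nat \<Rightarrow> real) \<Rightarrow> nat \<Rightarrow> real" where
  "stick n t i = (if i < n then t i else 1) * (\<Prod>j<i. 1 - t j)"

lemma stick_nonneg: "\<forall>j. t j \<in> {0..1} \<Longrightarrow> 0 \<le> stick n t i"
  by (auto simp: stick_def intro!: mult_nonneg_nonneg prod_nonneg)

lemma sum_stick: "(\<Sum>i\<le>n. stick n t i) = 1"
proof -
  have *: "(\<Sum>i<m. t i * (\<Prod>j<i. 1 - t j)) + (\<Prod>j<m. 1 - t j) = 1" for m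
    by (induction m) (auto simp: algebra_simps)
  have "(\<Sum>i\<le>n. stick n t i) = (\<Sum>i<n. stick n t i) + stick n t n"
    by (simp add: lessThan_Suc_atMost[symmetric])
  also have "(\<Sum>i<n. stick n t i) = (\<Sum>i<n. t i * (\<Prod>j<i. 1 - t j))"
    by (intro sum.cong) (auto simp: stick_def)
  finally show ?thesis using *[of n] by (simp add: stick_def)
qed

text \<open>Each \<open>t\<close> is labelled by an index of positive weight whose set contains
  \<open>\<phi> t\<close>. At a common limit of points of every label, closedness puts
  \<open>\<phi> t\<close> into all the sets.\<close>

theorem kkm:
  fixes y :: "nat \<Rightarrow> 'a::t2_locally_convex_space"
  assumes closed: "\<And>i. i \<le> n \<Longrightarrow> closed (C i)"
    and cover: "\<And>J. J \<subseteq> {..n} \<Longrightarrow> J \<noteq> {} \<Longrightarrow> convex hull (y ` J) \<subseteq> (\<Union>i\<in>J. C i)"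
  shows "(\<Inter>i\<le>n. C i) \<noteq> {}"
proof -
  define \<phi> where "\<phi> t = (\<Sum>i\<le>n. stick n t i *\<^sub>R y i)" for t
  have ex: "\<exists>i\<le>n. stick n t i > 0 \<and> \<phi> t \<in> C i" if t: "\<forall>j. t j \<in> {0..1}" for t
  proof -
    \<comment> \<open>Covering the face spanned by the positive weights only, instead of the whole
      simplex, forces the label to have positive weight.\<close>
    define J where "J = {i. i \<le> n \<and> stick n t i > 0}"
    have fin: "finite J" unfolding J_def by simp
    have zero: "stick n t i = 0" if "i \<in> {..n} - J" for i
      using that stick_nonneg[OF t, of n i] by (auto simp: J_def)
    have one: "(\<Sum>i\<in>J. stick n t i) = 1"
      unfolding sum_stick[of n t, symmetric]
      by (rule sum.mono_neutral_left) (use zero in \<open>auto simp: J_def\<close>)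
    then have "J \<noteq> {}" by auto
    have "\<phi> t = (\<Sum>i\<in>J. stick n t i *\<^sub>R y i)"
      unfolding \<phi>_def by (rule sum.mono_neutral_right) (use zero in \<open>auto simp: J_def\<close>)
    also have "\<dots> \<in> convex hull (y ` J)"
      by (rule convex_sum[OF fin convex_convex_hull one])
        (auto intro: hull_inc stick_nonneg[OF t])
    finally show ?thesis using cover[OF _ \<open>J \<noteq> {}\<close>] by (auto simp: J_def)
  qed
  define k where "k t = (SOME i. i \<le> n \<and> stick n t i > 0 \<and> \<phi> t \<in> C i)" for t
  have k: "k t \<le> n" "stick n t (k t) > 0" "\<phi> t \<in> C (k t)" if "\<forall>j. t j \<in> {0..1}" for t
    using someI_ex[OF ex[OF that]] unfolding k_def by auto
  have "\<exists>t. (\<forall>j. t j \<in> {0..1}) \<and> (\<forall>i\<le>n. \<exists>u :: nat \<Rightarrow> nat \<Rightarrow> real.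
    (\<forall>m j. u m j \<in> {0..1}) \<and> (\<forall>m. k (u m) = i) \<and> (\<forall>j. (\<lambda>m. u m j) \<longlonglongrightarrow> t j))"
  proof (rule cube_rainbow_limit)
    fix t :: "nat \<Rightarrow> real" and j assume t: "\<forall>j. t j \<in> {0..1}"
    show "k t \<le> n" by (rule k(1)[OF t])
    assume j: "j < n"
    { assume "t j = 0" with j k(2)[OF t] show "k t \<noteq> j" by (auto simp: stick_def) }
    { assume "t j = 1"
      show "k t \<le> j"
      proof (rule ccontr)
        assume "\<not> k t \<le> j"
        then have "(\<Prod>j<k t. 1 - t j) = 0" using \<open>t j = 1\<close> by (intro prod_zero) auto
        with k(2)[OF t] show False by (simp add: stick_def)
      qed }
  qed
  then obtain t where seq: "\<forall>i\<le>n. \<exists>u :: nat \<Rightarrow> nat \<Rightarrow> real.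
    (\<forall>m j. u m j \<in> {0..1}) \<and> (\<forall>m. k (u m) = i) \<and> (\<forall>j. (\<lambda>m. u m j) \<longlonglongrightarrow> t j)"
    by (elim exE conjE)
  have "\<phi> t \<in> C i" if i: "i \<le> n" for i
  proof -
    obtain u :: "nat \<Rightarrow> nat \<Rightarrow> real" where u: "\<And>m. \<forall>j. u m j \<in> {0..1}" "\<And>m. k (u m) = i"
      and lim: "\<And>j. (\<lambda>m. u m j) \<longlonglongrightarrow> t j"
      using seq i by meson
    have "(\<lambda>m. stick n (u m) i') \<longlonglongrightarrow> stick n t i'" for i'
      unfolding stick_def by (cases "i' < n") (auto intro!: tendsto_intros lim)
    then have "(\<lambda>m. \<phi> (u m)) \<longlonglongrightarrow> \<phi> t"
      unfolding \<phi>_def by (intro tendsto_sum tendsto_scaleR_lc tendsto_const)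
    moreover have "\<phi> (u m) \<in> C i" for m using k(3)[OF u(1)[of m]] u(2) by simp
    ultimately show ?thesis
      by (intro Lim_in_closed_set[OF closed[OF i]]) auto
  qed
  then show ?thesis by blast
qed

section \<open>Density in convex hulls of finite sets\<close>

text \<open>Two approximations are combined: a point on a segment from \<open>a\<close> to
  \<open>b\<close> is first moved by replacing \<open>b\<close> with a nearby \<open>q\<close> in
  \<open>U\<close>, and then approximated within the segment from \<open>a\<close> to
  \<open>q\<close>, whose ends both lie in \<open>U\<close>.\<close>

lemma self_segment_dense_convex_hull:
  fixes U V :: "'a::t2_locally_convex_space set"
  assumes dense: "self_segment_dense U V" and "finite S" "S \<subseteq> U"
  shows "convex hull S \<subseteq> closure (convex hull S \<inter> U)"
  using \<open>finite S\<close> \<open>S \<subseteq> U\<close>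
proof (induction S rule: finite_induct)
  case empty
  then show ?case by simp
next
  case (insert a S)
  show ?case
  proof (cases "S = {}")
    case True
    then show ?thesis using insert.prems closure_subset[of "{a}"] by simp
  next
    case False
    let ?H = "convex hull insert a S"
    have IH: "convex hull S \<subseteq> closure (convex hull S \<inter> U)"
      using insert by blast
    show ?thesis
    proof
      fix p assume "p \<in> ?H"
      then obtain u v b where uv: "u \<ge> 0" "v \<ge> 0" "u + v = 1"
        and b: "b \<in> convex hull S" and p: "p = u *\<^sub>R a + v *\<^sub>R b"
        by (auto simp: convex_hull_insert[OF False])
      \<comment> \<open>The weights are frozen and only the far end of the segment varies, so
        continuity of \<open>f\<close> transfers the induction hypothesis.\<close>
      define f where "f q = u *\<^sub>R a + v *\<^sub>R q" for q
      have cont: "continuous_on (closure (convex hull S \<inter> U)) f"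
        unfolding f_def continuous_on_def
        by (intro ballI tendsto_add tendsto_scaleR_lc tendsto_const tendsto_ident_at)
      have "f q \<in> closure (?H \<inter> U)" if q: "q \<in> convex hull S \<inter> U" for q
      proof -
        have "f q \<in> closed_segment a q"
          unfolding closed_segment_def f_def using uv by (auto intro!: exI[of _ v])
        also have "\<dots> \<subseteq> closure (closed_segment a q \<inter> U)"
          using dense q insert.prems by (auto simp: self_segment_dense_def)
        also have "\<dots> \<subseteq> closure (?H \<inter> U)"
        proof (intro closure_mono Int_mono order_refl closed_segment_subset convex_convex_hull)
          show "a \<in> ?H" by (simp add: hull_inc)
          show "q \<in> ?H" using q hull_mono[of S "insert a S" convex] by blast
        qed
        finally show ?thesis .
      qed
      then have "f ` closure (convex hull S \<inter> U) \<subseteq> closure (?H \<inter> U)"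
        by (intro image_closure_subset[OF cont]) auto
      then show "p \<in> closure (?H \<inter> U)" using IH b p by (auto simp: f_def)
    qed
  qed
qed

section \<open>Semicontinuity and concavity relative to the nonnegative half-line\<close>

lemma usc_at_neg:
  fixes T :: "'a::topological_space \<Rightarrow> real set"
  assumes "usc_at A T x" "T x \<inter> {0..} = {}"
  shows "\<exists>N. open N \<and> x \<in> N \<and> (\<forall>z\<in>A \<inter> N. T z \<inter> {0..} = {})"
proof -
  \<comment> \<open>The open half-line \<open>{..<0}\<close> is the test set for upper
    semicontinuity.\<close>
  have "T x \<subseteq> {..<0}" using assms(2) by (auto simp: not_le[symmetric])
  then obtain M where M: "openin (top_of_set A) M" "x \<in> M" "\<forall>z\<in>M. T z \<subseteq> {..<0}"
    using assms(1)[unfolded usc_at_def] open_lessThan[of "0::real"] by meson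
  then obtain N where "open N" "M = A \<inter> N" by (auto simp: openin_open)
  with M show ?thesis by (intro exI[of _ N]) force
qed

lemma usc_on_closed_nonneg:
  fixes T :: "'a::topological_space \<Rightarrow> real set"
  assumes "closed A" "usc_on A T A"
  shows "closed {x\<in>A. T x \<inter> {0..} \<noteq> {}}"
proof -
  have "open (- {x\<in>A. T x \<inter> {0..} \<noteq> {}})"
  proof (subst open_subopen, rule ballI)
    fix x assume x: "x \<in> - {x\<in>A. T x \<inter> {0..} \<noteq> {}}"
    show "\<exists>N. open N \<and> x \<in> N \<and> N \<subseteq> - {x\<in>A. T x \<inter> {0..} \<noteq> {}}"
    proof (cases "x \<in> A")
      case True
      with x usc_at_neg[of A T x] assms(2) show ?thesis
        unfolding usc_on_def by (simp add: subset_eq) blast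
    next
      case False
      with \<open>closed A\<close> show ?thesis by (intro exI[of _ "- A"]) auto
    qed
  qed
  then show ?thesis by (simp add: closed_def)
qed

text \<open>If all the \<open>T y\<close> were negative, every element of the weighted Minkowski sum
  would be a sum of nonpositive terms, one of them negative because some weight is positive; yet
  concavity places a nonnegative \<open>c\<close> there.\<close>

lemma set_concave_on_nonneg:
  assumes conc: "set_concave_on D T" and S: "finite S" "S \<subseteq> D"
    and x: "x \<in> convex hull S" "x \<in> D" and nonneg: "T x \<inter> {0..} \<noteq> {}"
  shows "\<exists>y\<in>S. T y \<inter> {0..} \<noteq> {}"
proof -
  obtain u where u: "\<And>v. v \<in> S \<Longrightarrow> 0 \<le> u v" "sum u S = 1" "(\<Sum>v\<in>S. u v *\<^sub>R v) = x"
    using x(1) by (auto simp: convex_hull_finite[OF S(1)])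
  obtain h where h: "bij_betw h {..<card S} S"
    using ex_bij_betw_nat_finite[OF S(1)] by (auto simp: atLeast0LessThan)
  then have hS: "h i \<in> S" if "i < card S" for i using that by (auto dest: bij_betwE)
  have sums: "(\<Sum>i<card S. u (h i)) = 1" "(\<Sum>i<card S. u (h i) *\<^sub>R h i) = x"
    using sum.reindex_bij_betw[OF h, of u] sum.reindex_bij_betw[OF h, of "\<lambda>v. u v *\<^sub>R v"] u by auto
  have "T x \<subseteq> (\<Sum>i<card S. u (h i) *o T (h i))"
    using conc[unfolded set_concave_on_def, rule_format, of "card S" h "u \<circ> h"] sums hS S(2) u(1) x(2)
    by auto
  moreover obtain c where c: "c \<in> T x" "0 \<le> c" using nonneg by auto
  ultimately have "c \<in> {sum s {..<card S} |s. \<forall>i\<in>{..<card S}. s i \<in> u (h i) *o T (h i)}"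
    using set_sum_alt[of "{..<card S}" "\<lambda>i. u (h i) *o T (h i)"] by auto
  with c obtain s where s: "\<And>i. i < card S \<Longrightarrow> s i \<in> u (h i) *o T (h i)"
    and "0 \<le> (\<Sum>i<card S. s i)"
    by auto
  have "\<exists>i<card S. u (h i) \<noteq> 0" using sums(1) by (metis lessThan_iff sum.neutral zero_neq_one)
  then obtain i where i: "i < card S" "0 < u (h i)" using u(1) hS by (metis less_le)
  show ?thesis
  proof (rule ccontr)
    assume "\<not> ?thesis"
    then have neg: "c < 0" if "y \<in> S" "c \<in> T y" for y c using that by (force simp: not_le[symmetric])
    have "s j \<le> 0" if "j < card S" for j
      using s[OF that] neg[OF hS[OF that]] u(1)[OF hS[OF that]]
      by (auto simp: elt_set_times_def mult_le_0_iff less_imp_le)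
    moreover have "s i < 0"
      using s[OF i(1)] neg[OF hS[OF i(1)]] i(2) by (auto simp: elt_set_times_def mult_less_0_iff)
    ultimately have "(\<Sum>i<card S. s i) < (\<Sum>i<card S. 0)"
      using i(1) by (intro sum_strict_mono_ex1) auto
    then show False using \<open>0 \<le> (\<Sum>i<card S. s i)\<close> by simp
  qed
qed

section \<open>The equilibrium point from KKM, compactness and density\<close>

theorem theorem4p2:
  fixes K D :: "'a::t2_locally_convex_space set"
    and F :: "'a \<Rightarrow> 'a \<Rightarrow> real set"
  assumes "K \<noteq> {}" and "convex K" and "closed K"
    and "D \<subseteq> K" and "self_segment_dense D K"
    and "\<forall>y\<in>D. usc_on K (\<lambda>x. F x y) K"
    and "\<forall>x\<in>K. usc_on K (\<lambda>y. F x y) (K - D)"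
    and "\<forall>x\<in>D. set_concave_on D (\<lambda>y. F x y)"
    and "\<forall>x\<in>D. F x x \<inter> {0..} \<noteq> {}"
    and "\<exists>K0 y0. compact K0 \<and> y0 \<in> D \<inter> K0 \<and> (\<forall>x\<in>K - K0. F x y0 \<inter> {0..} = {})"
  shows "\<exists>x0\<in>K. \<forall>y\<in>K. F x0 y \<inter> {0..} \<noteq> {}"
proof -
  obtain K0 y0 where K0: "compact K0" and y0: "y0 \<in> D"
    and out: "\<And>x. x \<in> K - K0 \<Longrightarrow> F x y0 \<inter> {0..} = {}"
    using assms(10) by blast
  define G where "G y = {x\<in>K. F x y \<inter> {0..} \<noteq> {}}" for y
  have G_closed: "closed (G y)" if "y \<in> D" for y
    unfolding G_def using usc_on_closed_nonneg[OF \<open>closed K\<close>] assms(6) that by blast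
  have cover: "convex hull S \<subseteq> (\<Union>y\<in>S. G y)" if S: "finite S" "S \<subseteq> D" for S
  proof -
    \<comment> \<open>For \<open>x\<close> in the hull and in \<open>D\<close>, concavity is applied
      to \<open>F x\<close> at \<open>x\<close> itself, where \<open>F x x\<close> meets
      \<open>{0..}\<close>.\<close>
    have "convex hull S \<inter> D \<subseteq> (\<Union>y\<in>S. G y)"
      using set_concave_on_nonneg[OF _ S] assms(4,8,9) unfolding G_def by fast
    moreover have "closed (\<Union>y\<in>S. G y)" using S G_closed by (intro closed_UN) auto
    ultimately have "closure (convex hull S \<inter> D) \<subseteq> (\<Union>y\<in>S. G y)" by (rule closure_minimal)
    then show ?thesis using self_segment_dense_convex_hull[OF assms(5) S] by blast
  qed
  have fip: "(\<Inter>y\<in>S. G y) \<noteq> {}" if S: "finite S" "S \<subseteq> D" "S \<noteq> {}" for S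
  proof -
    obtain h and n :: nat where h: "S = h ` {i. i < n}"
      using finite_imp_nat_seg_image_inj_on[OF S(1)] by blast
    then have hD: "h ` {..<n} \<subseteq> D" using S(2) by (simp add: lessThan_def)
    have "n \<noteq> 0" using h S(3) by auto
    \<comment> \<open>\<open>kkm\<close> counts its points from 0 to \<open>m\<close> inclusive,
      hence the shift from \<open>n\<close> to \<open>m\<close>.\<close>
    then obtain m where n: "n = Suc m" by (auto simp: gr0_conv_Suc)
    have hD': "h i \<in> D" if "i \<le> m" for i using that hD n by (simp add: image_subset_iff)
    have "(\<Inter>i\<le>m. G (h i)) \<noteq> {}"
    proof (rule kkm)
      show "closed (G (h i))" if "i \<le> m" for i using G_closed[OF hD'[OF that]] .
      show "convex hull (h ` J) \<subseteq> (\<Union>i\<in>J. G (h i))" if "J \<subseteq> {..m}" for J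
      proof -
        have "finite J" "h ` J \<subseteq> D" using that hD' finite_subset[OF that] by auto
        then show ?thesis using cover[of "h ` J"] by simp
      qed
    qed
    then show ?thesis by (auto simp: h n less_Suc_eq_le)
  qed
  have "(K0 \<inter> G y0) \<inter> (\<Inter>y\<in>D. G y) \<noteq> {}"
  proof (rule compact_imp_fip_image)
    show "compact (K0 \<inter> G y0)" using K0 G_closed[OF y0] by (rule compact_Int_closed)
    show "closed (G y)" if "y \<in> D" for y by (rule G_closed[OF that])
    fix S assume S: "finite S" "S \<subseteq> D"
    \<comment> \<open>Inserting \<open>y0\<close> makes the family nonempty and forces the common
      point into \<open>G y0\<close>, hence into \<open>K0\<close>.\<close>
    have "(\<Inter>y\<in>insert y0 S. G y) \<noteq> {}" using S y0 by (intro fip) auto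
    moreover have "G y0 \<subseteq> K0" using out unfolding G_def by blast
    ultimately show "(K0 \<inter> G y0) \<inter> (\<Inter>y\<in>S. G y) \<noteq> {}" by auto
  qed
  then obtain x0 where x0: "x0 \<in> K" and x0D: "\<And>y. y \<in> D \<Longrightarrow> F x0 y \<inter> {0..} \<noteq> {}"
    using y0 by (auto simp: G_def)
  \<comment> \<open>Otherwise \<open>F x0\<close> would miss \<open>{0..}\<close> on a whole
    neighbourhood of \<open>y\<close> in \<open>K\<close>, which contains points of \<open>D\<close>
    by density.\<close>
  have "F x0 y \<inter> {0..} \<noteq> {}" if y: "y \<in> K" "y \<notin> D" for y
  proof
    assume "F x0 y \<inter> {0..} = {}"
    moreover have "usc_at K (\<lambda>y. F x0 y) y" using assms(7) x0 y unfolding usc_on_def by blast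
    ultimately obtain N where N: "open N" "y \<in> N" "\<forall>z\<in>K \<inter> N. F x0 z \<inter> {0..} = {}"
      using usc_at_neg[of K "F x0" y] by metis
    have "y \<in> closure D" using assms(5) y(1) unfolding self_segment_dense_def by blast
    then have "N \<inter> D \<noteq> {}" using open_Int_closure_eq_empty[OF N(1)] N(2) by blast
    then show False using N(3) x0D assms(4) by blast
  qed
  then show ?thesis using x0 x0D by blast
qed

end
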